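(* Let $P$ be the set of all primes. The map $A\mapsto R_A$ from the power set $\mathcal{P}(P)$ to $[0,1]$ is surjective. That is, for each $\alpha\in[0,1]$ there is a set of primes $A\subseteq P$ such that $R_A=\alpha$.
   Context: For $A\subseteq P$, let $\Omega_A(n)$ be the number of prime factors of $n$ coming from $A$, counted with multiplicity, and let $\lambda_A(n)=(-1)^{\Omega_A(n)}$; equivalently, $\lambda_A$ is the completely multiplicative function with $\lambda_A(p)=-1$ for primes $p\in A$ and $\lambda_A(p)=1$ for primes $p\notin A$. Define the mean value $R_A:=\lim_{n\to\infty}\frac1n\sum_{k\le n}\lambda_A(k)$; this limit exists for every $A\subseteq P$, and it equals $\prod_{p\in A}\frac{p-1}{p+1}=\prod_{p\in A}\left(1-\frac{2}{p+1}\right)$ (interpreted as $0$ when $\sum_{p\in A}1/p$ diverges, and as $1$ when $A=\varnothing$). *)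

theory Defs
  imports Complex_Main "HOL-Computational_Algebra.Primes"
begin

definition Omega_on :: "nat set \<Rightarrow> nat \<Rightarrow> nat" where
  "Omega_on A n = size (filter_mset (\<lambda>p. p \<in> A) (prime_factorization n))"

definition liouville_on :: "nat set \<Rightarrow> nat \<Rightarrow> real" where
  "liouville_on A n = (-1) ^ Omega_on A n"

definition liouville_average :: "nat set \<Rightarrow> nat \<Rightarrow> real" where
  "liouville_average A n = (\<Sum>k=1..n. liouville_on A k) / real n"

(* lim is an unspecified real on a divergent sequence, so a statement that the mean value
   equals a given number is only meaningful together with convergent (liouville_average A). *)
definition mean_value :: "nat set \<Rightarrow> real" where
  "mean_value A = lim (liouville_average A)"

end

theory Submission
  imports Defs "HOL-Analysis.Harmonic_Numbers"
begin

text \<open>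
  For finite \<open>A\<close> the mean value is the product over \<open>A\<close> of \<open>(p - 1) / (p + 1)\<close>, by adding one prime
  at a time. Since the sum of \<open>1 / p\<close> over the primes diverges, products over blocks of large primes
  reach any target in \<open>(0, 1]\<close> up to a factor close to 1. The set \<open>A\<close> is a union of such finite
  blocks, chosen so that the products tend to \<open>\<alpha>\<close> slowly enough for the sum of \<open>1 / p\<close> over the
  \<open>j\<close>-th block to tend to 0, and so that each block starts only where the average of its
  predecessors has settled. At every \<open>n\<close> at most one block is then in transition, and it changes
  the average by at most twice its sum of \<open>1 / p\<close>. This treats \<open>\<alpha> = 0\<close> without the prime number
  theorem.
\<close>

section \<open>Dependence of \<open>liouville_on\<close> on the set, and splitting sums at a
  prime\<close>

lemma liouville_on_cong:
  assumes "\<And>p. prime p \<Longrightarrow> p dvd n \<Longrightarrow> n > 0 \<Longrightarrow> p \<in> A \<longleftrightarrow> p \<in> B"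
  shows "liouville_on A n = liouville_on B n"
proof -
  have "filter_mset (\<lambda>p. p \<in> A) (prime_factorization n) =
        filter_mset (\<lambda>p. p \<in> B) (prime_factorization n)"
    by (rule filter_mset_cong) (use assms in \<open>auto simp: in_prime_factors_iff\<close>)
  then show ?thesis by (simp add: liouville_on_def Omega_on_def)
qed

lemma liouville_on_prime_times:
  assumes "prime p" "k > 0"
  shows "liouville_on A (p * k) = (if p \<in> A then - liouville_on A k else liouville_on A k)"
  using assms by (simp add: liouville_on_def Omega_on_def prime_factorization_mult
      prime_factorization_prime)

lemma abs_liouville_on [simp]: "\<bar>liouville_on A n\<bar> = 1"
  by (simp add: liouville_on_def power_abs)

text \<open>Stated for any commutative monoid: it serves for real sums of
  \<open>liouville_on\<close> and, with values in \<open>nat\<close>, for counting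
  multiples.\<close>

lemma sum_split_multiples:
  fixes f :: "nat \<Rightarrow> 'a::comm_monoid_add"
  assumes "p > 0"
  shows "(\<Sum>k=1..n. f k) =
    (\<Sum>k | k \<in> {1..n} \<and> \<not> p dvd k. f k) + (\<Sum>k=1..n div p. f (p * k))"
proof -
  have "(\<Sum>k=1..n div p. f (p * k)) = (\<Sum>k | k \<in> {1..n} \<and> p dvd k. f k)"
  proof (rule sum.reindex_bij_betw)
    show "bij_betw ((*) p) {1..n div p} {k \<in> {1..n}. p dvd k}"
      using assms
      by (auto simp: bij_betw_def inj_on_def image_iff less_eq_div_iff_mult_less_eq mult.commute
          elim!: dvdE intro!: bexI)
  qed
  moreover have "(\<Sum>k=1..n. f k) =
      (\<Sum>k | k \<in> {1..n} \<and> \<not> p dvd k. f k) + (\<Sum>k | k \<in> {1..n} \<and> p dvd k. f k)"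
    by (subst sum.union_disjoint [symmetric]) (auto intro: sum.cong)
  ultimately show ?thesis by (simp only:)
qed

text \<open>Both functions agree on non-multiples of \<open>p\<close>; at \<open>p * k\<close> each
  takes its value at \<open>k\<close>, with the sign flipped for \<open>insert p A\<close>. The sum
  for \<open>insert p A\<close> therefore satisfies a recursion through
  \<open>n div p\<close>.\<close>

lemma liouville_sum_insert:
  assumes "prime p" "p \<notin> A"
  shows "(\<Sum>k=1..n. liouville_on (insert p A) k) =
    (\<Sum>k=1..n. liouville_on A k) - (\<Sum>k=1..n div p. liouville_on A k)
    - (\<Sum>k=1..n div p. liouville_on (insert p A) k)"
proof -
  have p: "p > 0" using assms by (simp add: prime_gt_0_nat)
  have "(\<Sum>k | k \<in> {1..n} \<and> \<not> p dvd k. liouville_on (insert p A) k)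
      = (\<Sum>k | k \<in> {1..n} \<and> \<not> p dvd k. liouville_on A k)"
    by (intro sum.cong refl liouville_on_cong) auto
  moreover have "(\<Sum>k=1..n div p. liouville_on (insert p A) (p * k))
      = - (\<Sum>k=1..n div p. liouville_on (insert p A) k)"
    unfolding sum_negf [symmetric]
    using assms by (intro sum.cong refl) (simp add: liouville_on_prime_times)
  moreover have "(\<Sum>k=1..n div p. liouville_on A (p * k)) = (\<Sum>k=1..n div p. liouville_on A k)"
    using assms by (intro sum.cong refl) (simp add: liouville_on_prime_times)
  ultimately show ?thesis
    using sum_split_multiples [OF p, of "liouville_on A" n]
      sum_split_multiples [OF p, of "liouville_on (insert p A)" n] by linarith
qed

section \<open>Mean values for finite sets of primes\<close>

lemma tendsto_div_over_n:
  assumes "p > 0"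
  shows "(\<lambda>n. real (n div p) / real n) \<longlonglongrightarrow> 1 / real p"
proof (rule tendsto_sandwich)
  show "(\<lambda>n. 1 / real p - 1 / real n) \<longlonglongrightarrow> 1 / real p"
    using tendsto_diff [OF tendsto_const lim_1_over_n, of "1 / real p"] by simp
  have "real n / real p - 1 \<le> real (n div p)" for n
    using real_of_int_div3 [of "int n" "int p"] by (simp flip: zdiv_int)
  then have "(real n / real p - 1) / real n \<le> real (n div p) / real n" for n
    by (intro divide_right_mono) auto
  moreover have "(real n / real p - 1) / real n = 1 / real p - 1 / real n" if "n \<ge> 1" for n
    using that assms by (simp add: field_simps)
  ultimately show "\<forall>\<^sub>F n in sequentially. 1 / real p - 1 / real n \<le> real (n div p) / real n"
    by (intro eventually_sequentiallyI [of 1]) metis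
  have "real (n div p) / real n \<le> (real n / real p) / real n" for n
    by (intro divide_right_mono of_nat_div_le_of_nat) auto
  moreover have "(real n / real p) / real n = 1 / real p" if "n \<ge> 1" for n
    using that by simp
  ultimately show "\<forall>\<^sub>F n in sequentially. real (n div p) / real n \<le> 1 / real p"
    by (intro eventually_sequentiallyI [of 1]) metis
qed auto

text \<open>Unrolling the recursion meets \<open>h\<close> at scales that shrink at least by half
  each time, so errors of size \<open>\<epsilon> / 2\<close> per unit length add up like a geometric
  series to at most \<open>\<epsilon> * n\<close>.\<close>

lemma sublinear_recursion:
  fixes e h :: "nat \<Rightarrow> real"
  assumes p: "p \<ge> 2" and e: "\<And>n. e n = h n - e (n div p)"
    and h: "(\<lambda>n. h n / real n) \<longlonglongrightarrow> 0"
  shows "(\<lambda>n. e n / real n) \<longlonglongrightarrow> 0"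
proof (rule LIMSEQ_I)
  fix r :: real assume r: "r > 0"
  define \<epsilon> where "\<epsilon> = r / 2"
  have \<epsilon>: "\<epsilon> > 0" using r by (simp add: \<epsilon>_def)
  obtain N where N: "\<And>n. n \<ge> N \<Longrightarrow> \<bar>h n / real n\<bar> < \<epsilon> / 2"
    using LIMSEQ_D [OF h, of "\<epsilon> / 2"] \<epsilon> by auto
  \<comment> \<open>The successor forces \<open>n > 0\<close> for \<open>n \<ge> M\<close>, which
    gives \<open>n div p < n\<close> for the induction. The constant \<open>C\<close> below covers
    all smaller \<open>n\<close>.\<close>
  define M where "M = Suc N"
  define C where "C = (\<Sum>k<M. \<bar>e k\<bar>)"
  have C: "C \<ge> 0" by (simp add: C_def sum_nonneg)
  have bound: "\<bar>e n\<bar> \<le> \<epsilon> * real n + C" for n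
  proof (induction n rule: less_induct)
    case (less n)
    show ?case
    proof (cases "n < M")
      case True
      then have "\<bar>e n\<bar> \<le> C"
        unfolding C_def by (intro member_le_sum) auto
      then show ?thesis using \<epsilon> by (simp add: add_increasing)
    next
      case False
      then have n: "n > 0" "n \<ge> N" by (auto simp: M_def)
      have "\<bar>h n\<bar> \<le> \<epsilon> / 2 * real n"
        using N [OF n(2)] n(1) by (simp add: abs_divide divide_less_eq)
      moreover have "\<bar>e (n div p)\<bar> \<le> \<epsilon> * real (n div p) + C"
        using n p by (intro less.IH) auto
      moreover have "real (n div p) \<le> real n / 2"
      proof -
        have "n div p \<le> n div 2" using p by (intro div_le_mono2) auto
        then show ?thesis by linarith
      qed
      then have "\<epsilon> * real (n div p) \<le> \<epsilon> * (real n / 2)"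
        using \<epsilon> by (intro mult_left_mono) auto
      ultimately show ?thesis unfolding e [of n] by (simp add: field_simps)
    qed
  qed
  obtain K where K: "C / \<epsilon> < real K" using reals_Archimedean2 by blast
  show "\<exists>no. \<forall>n\<ge>no. norm (e n / real n - 0) < r"
  proof (intro exI allI impI)
    fix n assume n: "n \<ge> Suc K"
    have "C / \<epsilon> < real n" using K n by linarith
    then have "C < \<epsilon> * real n" using \<epsilon> by (simp add: field_simps)
    then have "\<bar>e n\<bar> < r * real n" using bound [of n] by (simp add: \<epsilon>_def)
    then show "norm (e n / real n - 0) < r"
      using n by (simp add: abs_divide divide_less_eq)
  qed
qed

text \<open>The product defaults to 1 on infinite sets, so this is meaningful for finite
  \<open>A\<close>; the infinite case is reached as a limit over finite stages.\<close>

definition liouville_density :: "nat set \<Rightarrow> real" where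
  "liouville_density A = (\<Prod>p\<in>A. (real p - 1) / (real p + 1))"

lemma liouville_average_finite_tendsto:
  assumes "finite A" "\<And>p. p \<in> A \<Longrightarrow> prime p"
  shows "liouville_average A \<longlonglongrightarrow> liouville_density A"
  using assms
proof (induction A rule: finite_induct)
  case empty
  have "liouville_average {} n = 1" if "n \<ge> 1" for n
    using that by (simp add: liouville_average_def liouville_on_def Omega_on_def)
  then have "\<forall>\<^sub>F n in sequentially. liouville_average {} n = 1"
    by (intro eventually_sequentiallyI [of 1])
  then show ?case by (simp add: liouville_density_def tendsto_eventually)
next
  case (insert p A)
  define S where "S = (\<lambda>n. \<Sum>k=1..n. liouville_on A k)"
  define T where "T = (\<lambda>n. \<Sum>k=1..n. liouville_on (insert p A) k)"
  define R where "R = liouville_density A"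
  define L where "L = liouville_density (insert p A)"
  \<comment> \<open>The inhomogeneous term in the recursion for \<open>T n - L * n\<close>. It is
    sublinear because \<open>L * (1 + 1 / p) = R * (1 - 1 / p)\<close>.\<close>
  define h where "h = (\<lambda>n. S n - S (n div p) - L * real n - L * real (n div p))"
  have p: "prime p" using insert by auto
  then have p2: "p \<ge> 2" by (simp add: prime_ge_2_nat)
  have L: "L = (real p - 1) / (real p + 1) * R"
    using insert by (simp add: L_def R_def liouville_density_def)
  have S: "(\<lambda>n. S n / real n) \<longlonglongrightarrow> R"
    using insert by (simp add: S_def R_def liouville_average_def [abs_def])
  have "filterlim (\<lambda>n. n div p) sequentially sequentially"
    using p2 by (intro filterlim_at_top_div_const_nat) auto
  then have "(\<lambda>n. S (n div p) / real (n div p) * (real (n div p) / real n)) \<longlonglongrightarrow> R * (1 / real p)"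
    using p2 by (intro tendsto_mult tendsto_div_over_n filterlim_compose [OF S]) auto
  \<comment> \<open>For \<open>n < p\<close> both sides are 0: division by zero yields 0 and
    \<open>S 0\<close> is an empty sum.\<close>
  moreover have "(\<lambda>n. S (n div p) / real (n div p) * (real (n div p) / real n)) = (\<lambda>n. S (n div p) / real n)"
  proof
    fix n show "S (n div p) / real (n div p) * (real (n div p) / real n) = S (n div p) / real n"
      by (cases "n div p = 0") (simp_all add: S_def)
  qed
  ultimately have Sp: "(\<lambda>n. S (n div p) / real n) \<longlonglongrightarrow> R / real p"
    by (metis (no_types) mult.right_neutral times_divide_eq_right)
  have "(\<lambda>n. S n / real n - S (n div p) / real n - L - L * (real (n div p) / real n))
      \<longlonglongrightarrow> R - R / real p - L - L * (1 / real p)"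
    using p2 by (intro tendsto_intros S Sp tendsto_div_over_n) auto
  moreover have "R - R / real p - L - L * (1 / real p) = 0"
    using p2 by (simp add: L field_simps)
  ultimately have "(\<lambda>n. S n / real n - S (n div p) / real n - L - L * (real (n div p) / real n))
      \<longlonglongrightarrow> 0"
    by (simp only:)
  then have h: "(\<lambda>n. h n / real n) \<longlonglongrightarrow> 0"
    by (rule Lim_transform_eventually [OF _ eventually_sequentiallyI [of 1]])
      (simp add: h_def field_simps)
  have "T n - L * real n = h n - (T (n div p) - L * real (n div p))" for n
    using liouville_sum_insert [OF p insert.hyps(2), of n] by (simp add: T_def S_def h_def)
  then have "(\<lambda>n. (T n - L * real n) / real n) \<longlonglongrightarrow> 0"
    by (rule sublinear_recursion [OF p2 _ h])
  then have "(\<lambda>n. (T n - L * real n) / real n + L) \<longlonglongrightarrow> 0 + L"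
    by (intro tendsto_intros)
  then have "(\<lambda>n. (T n - L * real n) / real n + L) \<longlonglongrightarrow> L" by simp
  then show ?case
    unfolding L_def [symmetric]
    by (rule Lim_transform_eventually [OF _ eventually_sequentiallyI [of 1]])
      (simp add: T_def liouville_average_def field_simps)
qed

section \<open>Effect of a finite block of primes on the average\<close>

lemma card_multiples_le:
  assumes "p > 0"
  shows "real (card {k \<in> {1..n}. p dvd k}) \<le> real n / real p"
proof -
  have "card {k \<in> {1..n}. p dvd k} = n div p"
    using sum_split_multiples [OF assms, of "\<lambda>k. if p dvd k then 1::nat else 0" n]
    by (simp add: sum.If_cases Int_def)
  then show ?thesis by (simp add: of_nat_div_le_of_nat)
qed

text \<open>Only multiples of some prime in \<open>B\<close> can change value, each by at most 2,
  and a union bound counts them. The bound is uniform in \<open>n\<close>, so it controls a block in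
  transition.\<close>

lemma liouville_average_Un_diff:
  assumes "finite B" "\<And>p. p \<in> B \<Longrightarrow> p > 0"
  shows "\<bar>liouville_average (A \<union> B) n - liouville_average A n\<bar> \<le> 2 * (\<Sum>p\<in>B. 1 / real p)"
proof -
  define D where "D = (\<Union>p\<in>B. {k \<in> {1..n}. p dvd k})"
  have "\<bar>\<Sum>k=1..n. liouville_on (A \<union> B) k - liouville_on A k\<bar>
      \<le> (\<Sum>k=1..n. \<bar>liouville_on (A \<union> B) k - liouville_on A k\<bar>)"
    by (rule sum_abs)
  also have "\<dots> \<le> (\<Sum>k=1..n. if k \<in> D then 2 else 0)"
  proof (rule sum_mono)
    fix k assume k: "k \<in> {1..n}"
    show "\<bar>liouville_on (A \<union> B) k - liouville_on A k\<bar> \<le> (if k \<in> D then 2 else 0)"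
    proof (cases "k \<in> D")
      case True
      then show ?thesis
        using abs_triangle_ineq4 [of "liouville_on (A \<union> B) k" "liouville_on A k"] by simp
    next
      case False
      then have "liouville_on (A \<union> B) k = liouville_on A k"
        using k by (intro liouville_on_cong) (auto simp: D_def)
      then show ?thesis by simp
    qed
  qed
  also have "\<dots> = 2 * real (card D)"
  proof -
    have "{1..n} \<inter> {k. k \<in> D} = D" by (auto simp: D_def)
    then show ?thesis by (simp add: sum.If_cases)
  qed
  also have "real (card D) \<le> (\<Sum>p\<in>B. real (card {k \<in> {1..n}. p dvd k}))"
    using card_UN_le [OF assms(1), of "\<lambda>p. {k \<in> {1..n}. p dvd k}"]
    by (simp add: D_def flip: of_nat_sum)
  also have "\<dots> \<le> (\<Sum>p\<in>B. real n / real p)"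
    by (intro sum_mono card_multiples_le assms)
  also have "\<dots> = real n * (\<Sum>p\<in>B. 1 / real p)"
    by (simp add: sum_distrib_left)
  finally have "\<bar>\<Sum>k=1..n. liouville_on (A \<union> B) k - liouville_on A k\<bar>
      \<le> 2 * (\<Sum>p\<in>B. 1 / real p) * real n" by (simp add: mult_ac)
  then show ?thesis
    by (cases "n = 0")
      (simp_all add: liouville_average_def sum_subtractf divide_le_eq sum_nonneg
        flip: diff_divide_distrib)
qed

lemma liouville_density_pos:
  "(\<And>p. p \<in> A \<Longrightarrow> prime p) \<Longrightarrow> liouville_density A > 0"
  unfolding liouville_density_def
proof (rule prod_pos)
  fix p assume "\<And>p. p \<in> A \<Longrightarrow> prime p" "p \<in> A"
  then have "real p > 1" using prime_gt_1_nat by auto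
  then show "0 < (real p - 1) / (real p + 1)" by simp
qed

text \<open>The reciprocal density is the product of
  \<open>(p + 1) / (p - 1) \<ge> 1 + 1 / p\<close>, and expanding such a product gives at least 1
  plus the sum. Thus a block with density near 1 has a small sum of \<open>1 / p\<close>.\<close>

lemma sum_inverse_le_inverse_density:
  assumes "finite B" "\<And>p. p \<in> B \<Longrightarrow> prime p"
  shows "(\<Sum>p\<in>B. 1 / real p) \<le> 1 / liouville_density B - 1"
  using assms
proof (induction B rule: finite_induct)
  case empty
  then show ?case by (simp add: liouville_density_def)
next
  case (insert p B)
  define w where "w = 1 / liouville_density B"
  define c where "c = (\<Sum>p\<in>B. 1 / real p)"
  have p: "real p > 1" using insert prime_gt_1_nat [of p] by auto
  have IH: "c \<le> w - 1" using insert by (simp add: c_def w_def)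
  have "c \<ge> 0" by (simp add: c_def sum_nonneg)
  then have w: "w \<ge> 1" using IH by simp
  have "1 / real p \<le> (real p + 1) / (real p - 1) - 1"
    using p by (simp add: field_simps)
  also have "\<dots> \<le> w * \<dots>"
    using w p mult_right_mono [of 1 w "(real p + 1) / (real p - 1) - 1"] by simp
  finally have "1 / real p + c \<le> w * ((real p + 1) / (real p - 1)) - 1"
    using IH by (simp add: algebra_simps)
  moreover have "1 / liouville_density (insert p B) = w * ((real p + 1) / (real p - 1))"
    using insert by (simp add: liouville_density_def w_def)
  ultimately show ?case using insert by (simp add: c_def)
qed

section \<open>Products over large primes tend to 0\<close>

text \<open>A finite form of the Euler product: with \<open>P\<close> all primes up to \<open>n\<close>, the sum is the harmonic number.\<close>

lemma sum_inverse_smooth_le: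
  assumes "finite P" "\<And>p. p \<in> P \<Longrightarrow> prime p"
  shows "(\<Sum>k | k \<in> {1..n} \<and> prime_factors k \<subseteq> P. 1 / real k) * (\<Prod>p\<in>P. 1 - 1 / real p) \<le> 1"
  using assms
proof (induction P rule: finite_induct)
  case empty
  have "{k. k \<in> {1..n} \<and> prime_factors k \<subseteq> {}} \<subseteq> {1}"
    by (auto simp: prime_factorization_empty_iff)
  then have "(\<Sum>k | k \<in> {1..n} \<and> prime_factors k \<subseteq> {}. 1 / real k) \<le> (\<Sum>k\<in>{1}. 1 / real k)"
    by (intro sum_mono2) auto
  then show ?case by simp
next
  case (insert p P)
  have p: "prime p" using insert by auto
  then have p0: "p > 1" by (rule prime_gt_1_nat)
  define H where "H = (\<lambda>P. \<Sum>k | k \<in> {1..n} \<and> prime_factors k \<subseteq> P. 1 / real k)"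
  define X where "X = {k. k \<in> {1..n} \<and> prime_factors k \<subseteq> insert p P}"
  have finX: "finite X" by (simp add: X_def)
  have "H (insert p P) = sum (\<lambda>k. 1 / real k) X" by (simp add: H_def X_def)
  \<comment> \<open>A member of \<open>X\<close> is free of \<open>p\<close> or equals
    \<open>p * m\<close> with \<open>m\<close> again in \<open>X\<close>; image points beyond
    \<open>n\<close> only enlarge the sum. This yields
    \<open>H (insert p P) \<le> H P + H (insert p P) / p\<close>, replacing the geometric series in
    \<open>1 / p\<close>.\<close>
  also have "\<dots> \<le> (\<Sum>k\<in>{k. k \<in> {1..n} \<and> prime_factors k \<subseteq> P} \<union> (*) p ` X. 1 / real k)"
  proof (rule sum_mono2)
    show "X \<subseteq> {k. k \<in> {1..n} \<and> prime_factors k \<subseteq> P} \<union> (*) p ` X"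
    proof
      fix k assume k: "k \<in> X"
      show "k \<in> {k. k \<in> {1..n} \<and> prime_factors k \<subseteq> P} \<union> (*) p ` X"
      proof (cases "p dvd k")
        case True
        then obtain m where m: "k = p * m" by (elim dvdE)
        have m0: "m > 0" using k m by (auto simp: X_def intro: Nat.gr0I)
        have "m \<le> k" using m p0 by simp
        moreover have "prime_factors m \<subseteq> prime_factors k"
          using m m0 p0 by (intro dvd_prime_factors) auto
        ultimately have "m \<in> X" using k m0 by (auto simp: X_def)
        then show ?thesis using m by auto
      next
        case False
        then show ?thesis using k by (auto simp: X_def in_prime_factors_iff)
      qed
    qed
  qed (use finX in auto)
  also have "\<dots> \<le> H P + (\<Sum>k\<in>(*) p ` X. 1 / real k)"
    unfolding H_def using finX by (subst sum.union_inter [symmetric]) (auto intro!: sum_nonneg)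
  also have "(\<Sum>k\<in>(*) p ` X. 1 / real k) = (\<Sum>k\<in>X. 1 / real (p * k))"
    using p0 by (subst sum.reindex) (auto simp: inj_on_def)
  also have "\<dots> = 1 / real p * H (insert p P)"
    by (simp add: H_def X_def sum_distrib_left)
  finally have "H (insert p P) * (1 - 1 / real p) \<le> H P"
    by (simp add: algebra_simps)
  then have "H (insert p P) * (1 - 1 / real p) * (\<Prod>p\<in>P. 1 - 1 / real p)
      \<le> H P * (\<Prod>p\<in>P. 1 - 1 / real p)"
    using insert.prems by (intro mult_right_mono prod_nonneg) (auto dest!: prime_gt_0_nat simp: divide_le_eq)
  also have "\<dots> \<le> 1" using insert by (simp add: H_def)
  finally show ?case using insert by (simp add: H_def mult_ac)
qed

lemma prod_one_minus_inverse_primes_le: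
  assumes "n > 0"
  shows "(\<Prod>p | prime p \<and> p \<le> n. 1 - 1 / real p) \<le> 1 / harm n"
proof -
  have "{k. k \<in> {1..n} \<and> prime_factors k \<subseteq> {p. prime p \<and> p \<le> n}} = {1..n}"
    by (auto simp: in_prime_factors_iff intro: order_trans [OF dvd_imp_le])
  moreover have "(harm n :: real) = (\<Sum>k\<in>{1..n}. 1 / real k)"
    by (simp add: harm_def inverse_eq_divide)
  moreover have "finite {p. prime p \<and> p \<le> n}" by simp
  ultimately have "harm n * (\<Prod>p | prime p \<and> p \<le> n. 1 - 1 / real p) \<le> 1"
    using sum_inverse_smooth_le [of "{p. prime p \<and> p \<le> n}" n] by (metis (no_types, lifting) mem_Collect_eq)
  moreover have "(harm n :: real) > 0" using assms by (rule harm_pos)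
  ultimately show ?thesis by (simp only: pos_le_divide_eq mult.commute)
qed

text \<open>Each factor is at most \<open>1 - 1 / p\<close>, and the primes below \<open>M\<close>
  contribute a fixed positive constant \<open>c\<close> that can be divided out, so the divergence
  of the harmonic series forces the limit.\<close>

lemma liouville_density_primes_from_tendsto_0:
  "(\<lambda>n. liouville_density {p. prime p \<and> M \<le> p \<and> p < n}) \<longlonglongrightarrow> 0"
proof -
  define f where "f = (\<lambda>p::nat. 1 - 1 / real p)"
  define c where "c = (\<Prod>p | prime p \<and> p < M. f p)"
  have fpos: "f p > 0" if "prime p" for p
    using prime_gt_1_nat [OF that] by (simp add: f_def)
  have c: "c > 0" unfolding c_def by (intro prod_pos) (auto intro: fpos)
  \<comment> \<open>Shifted to \<open>Suc n\<close> so that \<open>p < Suc n\<close> matches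
    \<open>p \<le> n\<close> in the harmonic bound.\<close>
  have upper: "liouville_density {p. prime p \<and> M \<le> p \<and> p < Suc n} \<le> 1 / harm n / c"
    if n: "n \<ge> M" "n > 0" for n
  proof -
    have "liouville_density {p. prime p \<and> M \<le> p \<and> p < Suc n}
        \<le> (\<Prod>p | prime p \<and> M \<le> p \<and> p < Suc n. f p)"
      unfolding liouville_density_def
    proof (intro prod_mono conjI)
      fix p assume "p \<in> {p. prime p \<and> M \<le> p \<and> p < Suc n}"
      then have "real p > 1" by (auto dest: prime_gt_1_nat)
      then show "0 \<le> (real p - 1) / (real p + 1)" "(real p - 1) / (real p + 1) \<le> f p"
        by (auto simp: f_def field_simps)
    qed
    moreover have "(\<Prod>p | prime p \<and> M \<le> p \<and> p < Suc n. f p) * c = (\<Prod>p | prime p \<and> p \<le> n. f p)"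
      unfolding c_def using n
      by (subst prod.union_disjoint [symmetric]) (auto intro!: prod.cong)
    ultimately show ?thesis
      using prod_one_minus_inverse_primes_le [OF n(2)] c
      unfolding f_def pos_le_divide_eq [OF c]
      by (metis (no_types, lifting) less_imp_le mult_right_mono order_trans)
  qed
  have lim: "(\<lambda>n. 1 / harm n / c) \<longlonglongrightarrow> 0"
    using tendsto_divide [OF tendsto_inverse_0_at_top [OF harm_at_top] tendsto_const, of c] c
    by (simp add: inverse_eq_divide)
  have "(\<lambda>n. liouville_density {p. prime p \<and> M \<le> p \<and> p < Suc n}) \<longlonglongrightarrow> 0"
  proof (rule tendsto_sandwich [OF _ _ tendsto_const lim])
    show "\<forall>\<^sub>F n in sequentially. 0 \<le> liouville_density {p. prime p \<and> M \<le> p \<and> p < Suc n}"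
      by (intro always_eventually allI less_imp_le liouville_density_pos) auto
    show "\<forall>\<^sub>F n in sequentially.
        liouville_density {p. prime p \<and> M \<le> p \<and> p < Suc n} \<le> 1 / harm n / c"
      by (rule eventually_sequentiallyI [of "Suc M"], rule upper) auto
  qed
  then show ?thesis by (rule LIMSEQ_imp_Suc)
qed

section \<open>Reaching a target with a finite block of large primes\<close>

text \<open>Greedy choice: primes are added in increasing order, stopping just before the product
  would drop below \<open>t\<close>. Since the next prime would cost a factor of at most
  \<open>\<eta>\<close>, the product is then at most \<open>\<eta> * t\<close>.\<close>

lemma exists_primes_density_near:
  fixes r t \<eta> :: real
  assumes t: "0 < t" "t \<le> r" and \<eta>: "\<eta> > 1"
  obtains B where "finite B" "B \<subseteq> {p. prime p \<and> N \<le> p}"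
    "t \<le> r * liouville_density B" "r * liouville_density B \<le> \<eta> * t"
proof -
  obtain K where K: "(\<eta> + 1) / (\<eta> - 1) < real K" using reals_Archimedean2 by blast
  \<comment> \<open>Beyond \<open>K\<close>, a single prime changes the product by a factor of at most \<open>\<eta>\<close>.\<close>
  define M where "M = max N K"
  define B where "B = (\<lambda>n. {p. prime p \<and> M \<le> p \<and> p < n})"
  have "(\<lambda>n. r * liouville_density (B n)) \<longlonglongrightarrow> r * 0"
    unfolding B_def by (intro tendsto_intros liouville_density_primes_from_tendsto_0)
  then have "\<forall>\<^sub>F n in sequentially. r * liouville_density (B n) < t"
    using t by (intro order_tendstoD(2)) auto
  then obtain n where n: "r * liouville_density (B n) < t"
    by (meson eventually_happens sequentially_bot)
  define m where "m = (LEAST n. r * liouville_density (B n) < t)"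
  have m: "r * liouville_density (B m) < t"
    unfolding m_def using n by (rule LeastI)
  have less: "t \<le> r * liouville_density (B k)" if "k < m" for k
    using not_less_Least that unfolding m_def by (meson not_less)
  \<comment> \<open>\<open>B 0\<close> is empty and has density 1, while \<open>t \<le> r\<close>;
    so the first stage below \<open>t\<close> has a predecessor.\<close>
  have "m \<noteq> 0" using m t by (intro notI) (simp add: B_def liouville_density_def)
  then obtain k where k: "m = Suc k" by (cases m) auto
  have fin: "finite (B k)" by (simp add: B_def)
  show thesis
  proof (rule that [OF fin])
    show "t \<le> r * liouville_density (B k)" using less k by simp
    show "r * liouville_density (B k) \<le> \<eta> * t"
    proof (cases "prime k \<and> M \<le> k")
      case True
      then have "B m = insert k (B k)" by (auto simp: B_def k)
      moreover have "k \<notin> B k" by (simp add: B_def)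
      ultimately have eq: "liouville_density (B m) =
          (real k - 1) / (real k + 1) * liouville_density (B k)"
        using fin by (simp add: liouville_density_def)
      have k1: "real k > 1" using True by (auto dest: prime_gt_1_nat)
      have "(\<eta> + 1) / (\<eta> - 1) < real k" using K True by (simp add: M_def)
      then have "real k + 1 \<le> \<eta> * (real k - 1)" using \<eta> by (simp add: field_simps)
      then have ge: "1 \<le> \<eta> * ((real k - 1) / (real k + 1))" using k1 by (simp add: field_simps)
      have "liouville_density (B k) > 0"
        by (intro liouville_density_pos) (auto simp: B_def)
      then have "r * liouville_density (B k)
          \<le> \<eta> * ((real k - 1) / (real k + 1)) * (r * liouville_density (B k))"
        using ge t mult_right_mono [OF ge, of "r * liouville_density (B k)"] by simp
      also have "\<dots> = \<eta> * (r * liouville_density (B m))" by (simp add: eq)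
      also have "\<dots> \<le> \<eta> * t" using m \<eta> by (intro mult_left_mono) auto
      finally show ?thesis .
    next
      case False
      then have "B m = B k" by (auto simp: B_def k less_Suc_eq)
      then have "r * liouville_density (B k) < t" using m by simp
      also have "t \<le> \<eta> * t" using t \<eta> by simp
      finally show ?thesis by simp
    qed
  qed (auto simp: B_def M_def)
qed

section \<open>Construction of the set in blocks and convergence of its average\<close>

theorem theorem4:
  shows "\<forall>\<alpha>\<in>{0..1::real}. \<exists>A \<subseteq> {p::nat. prime p}.
           convergent (liouville_average A) \<and> mean_value A = \<alpha>"
proof
  fix \<alpha> :: real assume \<alpha>: "\<alpha> \<in> {0..1}"
  \<comment> \<open>Targets falling from 1 to \<open>\<alpha>\<close>, positive even for
    \<open>\<alpha> = 0\<close>, and slow enough that consecutive ratios are at most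
    \<open>1 + 1 / (j + 1)\<close>.\<close>
  define t where "t = (\<lambda>j. \<alpha> + (1 - \<alpha>) / real (Suc j))"
  \<comment> \<open>A state pairs the finite set built so far with a point \<open>x\<close> beyond
    it from which its average has settled up to \<open>1 / (j + 1)\<close>. By \<open>Q\<close>, the
    next block starts no earlier than \<open>x\<close>.\<close>
  define P where "P = (\<lambda>j (A, x). finite A \<and> A \<subseteq> {p. prime p} \<and> A \<subseteq> {..<x}
    \<and> t j \<le> liouville_density A \<and> liouville_density A \<le> (1 + 1 / real (Suc j)) * t j
    \<and> (\<forall>n\<ge>x. \<bar>liouville_average A n - liouville_density A\<bar> < 1 / real (Suc j)))"
  define Q where "Q = (\<lambda>(A, x) (A', x'). x < x' \<and> A \<subseteq> A' \<and> A' - A \<subseteq> {x::nat..})"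
  have tpos: "t j > 0" for j
    using \<alpha> by (cases "\<alpha> = 0") (auto simp: t_def intro!: add_pos_nonneg)
  have tdec: "t (Suc j) \<le> t j" for j
    using \<alpha> by (auto simp: t_def intro!: divide_left_mono)
  have tratio: "t j \<le> (1 + 1 / real (Suc j)) * t (Suc j)" for j
  proof -
    have "real (Suc j) > 0" by simp
    then have "(1 + 1 / real (Suc j)) * t (Suc j) = t j + \<alpha> / real (Suc j)"
      unfolding t_def by (simp add: divide_simps) (simp add: algebra_simps)
    then show ?thesis using \<alpha> by simp
  qed
  have threshold: "\<exists>x'\<ge>x. A \<subseteq> {..<x'} \<and>
      (\<forall>n\<ge>x'. \<bar>liouville_average A n - liouville_density A\<bar> < 1 / real (Suc j))"
    if A: "finite A" "A \<subseteq> {p. prime p}" for A x j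
  proof -
    obtain N where "\<forall>n\<ge>N. \<bar>liouville_average A n - liouville_density A\<bar> < 1 / real (Suc j)"
      using LIMSEQ_D [OF liouville_average_finite_tendsto, of A "1 / real (Suc j)"] A by auto
    moreover obtain M where "A \<subseteq> {..<M}" using A(1) finite_nat_iff_bounded by blast
    ultimately show ?thesis
      by (intro exI [of _ "max x (max N M)"]) fastforce
  qed
  have "\<exists>s. \<forall>j. P j (s j) \<and> Q (s j) (s (Suc j))"
  proof (rule dependent_nat_choice)
    obtain x where "\<forall>n\<ge>x. \<bar>liouville_average {} n - liouville_density {}\<bar> < 1 / real (Suc 0)"
      using threshold [of "{}" 0 0] by auto
    then have "P 0 ({}, x)" by (simp add: P_def t_def liouville_density_def)
    then show "\<exists>s. P 0 s" ..
  next
    fix s j assume s: "P j s"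
    obtain A x where Ax: "s = (A, x)" by (cases s)
    have A: "finite A" "A \<subseteq> {p. prime p}" "A \<subseteq> {..<x}" "t j \<le> liouville_density A"
      using s by (auto simp: P_def Ax)
    have le: "t (Suc j) \<le> liouville_density A" using A(4) tdec [of j] by simp
    have gt: "1 + 1 / real (Suc (Suc j)) > 1" by simp
    obtain B where B: "finite B" "B \<subseteq> {p. prime p \<and> x \<le> p}"
      "t (Suc j) \<le> liouville_density A * liouville_density B"
      "liouville_density A * liouville_density B \<le> (1 + 1 / real (Suc (Suc j))) * t (Suc j)"
      by (rule exists_primes_density_near [OF tpos le gt, of x]) (rule that)
    have "A \<inter> B = {}" using A(3) B(2) by fastforce
    then have AB: "liouville_density (A \<union> B) = liouville_density A * liouville_density B"
      using A B by (simp add: liouville_density_def prod.union_disjoint)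
    have AB': "finite (A \<union> B)" "A \<union> B \<subseteq> {p. prime p}" using A B by auto
    obtain x' where "x' \<ge> Suc x" "A \<union> B \<subseteq> {..<x'}"
      "\<forall>n\<ge>x'. \<bar>liouville_average (A \<union> B) n - liouville_density (A \<union> B)\<bar> < 1 / real (Suc (Suc j))"
      using threshold [OF AB', of "Suc x" "Suc j"] by blast
    then have "P (Suc j) (A \<union> B, x')" "Q s (A \<union> B, x')"
      unfolding P_def Q_def Ax prod.case AB using AB' B by (blast, fastforce)
    then show "\<exists>s'. P (Suc j) s' \<and> Q s s'" by blast
  qed
  then obtain s where s: "\<And>j. P j (s j)" "\<And>j. Q (s j) (s (Suc j))" by blast
  define F where "F = (\<lambda>j. fst (s j))"
  define x where "x = (\<lambda>j. snd (s j))"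
  have sF: "s j = (F j, x j)" for j by (simp add: F_def x_def)
  have F: "finite (F j)" "F j \<subseteq> {p. prime p}" "t j \<le> liouville_density (F j)"
      "liouville_density (F j) \<le> (1 + 1 / real (Suc j)) * t j"
      "\<And>n. n \<ge> x j \<Longrightarrow> \<bar>liouville_average (F j) n - liouville_density (F j)\<bar> < 1 / real (Suc j)"
    for j using s(1) [of j] by (auto simp: P_def sF)
  have step: "x j < x (Suc j)" "F j \<subseteq> F (Suc j)" "F (Suc j) - F j \<subseteq> {x j..}" for j
    using s(2) [of j] by (auto simp: Q_def sF)
  have x: "strict_mono x" using step by (simp add: strict_mono_Suc_iff)
  have Fmono: "F i \<subseteq> F j" if "i \<le> j" for i j
    using step(2) that by (rule lift_Suc_mono_le)
  \<comment> \<open>Below \<open>x j\<close> no later stage adds anything, so the final set agrees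
    there with \<open>F j\<close>.\<close>
  have Fnew: "F i \<subseteq> F j \<union> {x j..}" for i j
  proof (induction i)
    case (Suc i)
    show ?case
    proof (cases "i < j")
      case True
      then show ?thesis using Fmono [of "Suc i" j] by auto
    next
      case False
      then have "x j \<le> x i" using x by (simp add: strict_mono_less_eq)
      then show ?thesis using Suc step(3) [of i] by fastforce
    qed
  qed (use Fmono [of 0 j] in auto)
  define A where "A = (\<Union>j. F j)"
  \<comment> \<open>The first summand bounds the effect of the block in transition, the second is
    the tolerance to which its predecessors have settled.\<close>
  define \<delta> where "\<delta> = (\<lambda>j. 2 * ((1 + 1 / real (Suc j)) ^ 2 - 1) + 1 / real (Suc j))"
  have near: "\<bar>liouville_average A n - liouville_density (F j)\<bar> \<le> \<delta> j"
    if n: "x j \<le> n" "n < x (Suc j)" for j n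
  proof -
    define B where "B = F (Suc j) - F j"
    have B: "finite B" "\<And>p. p \<in> B \<Longrightarrow> prime p" using F(1,2) [of "Suc j"] by (auto simp: B_def)
    have FB: "F (Suc j) = F j \<union> B" using step(2) [of j] by (auto simp: B_def)
    have "liouville_average A n = liouville_average (F (Suc j)) n"
      unfolding liouville_average_def
    proof (intro arg_cong2 [of _ _ _ _ "(/)"] sum.cong refl liouville_on_cong)
      fix k p assume "k \<in> {1..n}" "p dvd k" "prime p"
      then have "p < x (Suc j)" using n by (auto dest: dvd_imp_le)
      then show "p \<in> A \<longleftrightarrow> p \<in> F (Suc j)"
        using Fnew [of _ "Suc j"] by (fastforce simp: A_def)
    qed
    moreover have "\<bar>liouville_average (F (Suc j)) n - liouville_average (F j) n\<bar>
        \<le> 2 * (\<Sum>p\<in>B. 1 / real p)"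
      unfolding FB using B by (intro liouville_average_Un_diff) (auto intro: prime_gt_0_nat)
    moreover have "(\<Sum>p\<in>B. 1 / real p) \<le> 1 / liouville_density B - 1"
      using B by (rule sum_inverse_le_inverse_density)
    \<comment> \<open>One factor is the excess of the density of \<open>F j\<close> over
      \<open>t j\<close>, the other the ratio of \<open>t j\<close> to
      \<open>t (Suc j)\<close>.\<close>
    moreover have "1 / liouville_density B \<le> (1 + 1 / real (Suc j)) ^ 2"
    proof -
      have "liouville_density (F (Suc j)) = liouville_density (F j) * liouville_density B"
        unfolding FB liouville_density_def using F(1) B
        by (intro prod.union_disjoint) (auto simp: B_def)
      moreover have "liouville_density B > 0" using B by (intro liouville_density_pos)
      moreover have "liouville_density (F j) \<le> (1 + 1 / real (Suc j)) ^ 2 * liouville_density (F (Suc j))"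
      proof -
        have "liouville_density (F j) \<le> (1 + 1 / real (Suc j)) * t j" by (rule F)
        also have "\<dots> \<le> (1 + 1 / real (Suc j)) * ((1 + 1 / real (Suc j)) * t (Suc j))"
          by (intro mult_left_mono tratio) auto
        also have "\<dots> \<le> (1 + 1 / real (Suc j)) * ((1 + 1 / real (Suc j)) * liouville_density (F (Suc j)))"
          by (intro mult_left_mono F) auto
        finally show ?thesis by (simp add: power2_eq_square mult_ac)
      qed
      moreover have "liouville_density (F j) > 0" using F(3) tpos less_le_trans by blast
      ultimately show ?thesis by (simp add: pos_divide_le_eq)
    qed
    ultimately have "\<bar>liouville_average A n - liouville_average (F j) n\<bar>
        \<le> 2 * ((1 + 1 / real (Suc j)) ^ 2 - 1)"
      by simp
    then show ?thesis
      using F(5) [OF n(1)] abs_triangle_ineq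
        [of "liouville_average A n - liouville_average (F j) n"
          "liouville_average (F j) n - liouville_density (F j)"]
      by (simp add: \<delta>_def)
  qed
  have inv: "(\<lambda>j. 1 / real (Suc j)) \<longlonglongrightarrow> 0" using LIMSEQ_inverse_real_of_nat
    by (simp add: inverse_eq_divide)
  have "(\<lambda>j. \<alpha> + (1 - \<alpha>) * (1 / real (Suc j))) \<longlonglongrightarrow> \<alpha> + (1 - \<alpha>) * 0"
    by (intro tendsto_intros inv)
  then have t: "t \<longlonglongrightarrow> \<alpha>" by (simp add: t_def)
  have "(\<lambda>j. (1 + 1 / real (Suc j)) * t j) \<longlonglongrightarrow> (1 + 0) * \<alpha>"
    by (intro tendsto_intros inv t)
  then have upper: "(\<lambda>j. (1 + 1 / real (Suc j)) * t j) \<longlonglongrightarrow> \<alpha>" by simp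
  have dens: "(\<lambda>j. liouville_density (F j)) \<longlonglongrightarrow> \<alpha>"
    by (rule tendsto_sandwich [OF always_eventually always_eventually t upper])
      (rule allI, rule F)+
  have "\<delta> \<longlonglongrightarrow> 2 * ((1 + 0) ^ 2 - 1) + 0"
    unfolding \<delta>_def by (intro tendsto_intros inv)
  then have \<delta>: "\<delta> \<longlonglongrightarrow> 0" by simp
  have "liouville_average A \<longlonglongrightarrow> \<alpha>"
  proof (rule LIMSEQ_I)
    fix r :: real assume r: "r > 0"
    obtain J where J: "\<And>j. j \<ge> J \<Longrightarrow> \<bar>liouville_density (F j) - \<alpha>\<bar> < r / 2"
      using LIMSEQ_D [OF dens, of "r / 2"] r by auto
    obtain K where K: "\<And>j. j \<ge> K \<Longrightarrow> \<bar>\<delta> j\<bar> < r / 2"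
      using LIMSEQ_D [OF \<delta>, of "r / 2"] r by auto
    show "\<exists>no. \<forall>n\<ge>no. norm (liouville_average A n - \<alpha>) < r"
    proof (intro exI allI impI)
      fix n assume n: "n \<ge> x (max J K)"
      \<comment> \<open>The predecessor \<open>j\<close> of \<open>i\<close> gives the window from
        \<open>x j\<close> up to \<open>x (Suc j)\<close> containing \<open>n\<close>; the choice of
        \<open>n\<close> makes \<open>j\<close> at least \<open>max J K\<close>.\<close>
      define i where "i = (LEAST i. n < x i)"
      have ex: "n < x (Suc n)" using strict_mono_imp_increasing [OF x, of "Suc n"] by simp
      have i: "n < x i" unfolding i_def using ex by (rule LeastI)
      then have "x (max J K) < x i" using n by (rule le_less_trans [rotated])
      then have "max J K < i" by (simp only: strict_mono_less [OF x])
      then obtain j where j: "i = Suc j" "max J K \<le> j" by (cases i) auto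
      have "x j \<le> n" using not_less_Least [of j "\<lambda>i. n < x i"] j by (simp add: i_def)
      then have "\<bar>liouville_average A n - liouville_density (F j)\<bar> \<le> \<delta> j"
        using i j(1) by (intro near) auto
      moreover have "\<bar>liouville_density (F j) - \<alpha>\<bar> < r / 2" "\<bar>\<delta> j\<bar> < r / 2"
        using J [of j] K [of j] j(2) by auto
      ultimately show "norm (liouville_average A n - \<alpha>) < r"
        unfolding real_norm_def by linarith
    qed
  qed
  then have "convergent (liouville_average A) \<and> mean_value A = \<alpha>"
    by (auto simp: mean_value_def convergent_def limI)
  moreover have "A \<subseteq> {p. prime p}" using F(2) by (auto simp: A_def)
  ultimately show "\<exists>A \<subseteq> {p::nat. prime p}. convergent (liouville_average A) \<and> mean_value A = \<alpha>"
    by blast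
qed

end
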